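(* Let $R>0$ and let $\phi$ satisfy $-\frac{\pi}{2}<\phi<\frac{\pi}{2}$, $\phi\neq 0$. Put $u=(\cos\phi,\sin\phi)$, $v=(-\sin\phi,\cos\phi)$, $L_\phi=\mathbb{R}u$, $L_\phi^{+}=\{ru:r>0\}$, and use rotated coordinates $(\xi,\eta)$ on $\mathbb{R}^2$ defined by $x=\xi u+\eta v$. For each $d>0$ let $\Gamma_d$ be the carrier conic of $f_R(\ell_d)$, where $\ell_d$ is the vertical line at abscissa $d$. Let $P_d$ be the intersection of $L_\phi^{+}$ with $\Gamma_d$ at polar angle $\theta=\phi$ on the focus-side branch of $\Gamma_d$, and let $N_d$ be the normal line to $\Gamma_d$ at $P_d$. Then: (1) as $d$ ranges over $(0,\infty)$, the lines $N_d$ are tangent to the fixed parabola $$\eta=\frac{\tan\phi}{4R}\,(R-\xi)^2;$$ (2) the points of tangency trace precisely the open arc $-R<\xi<R$ of this parabola; (3) the vertex of this parabola is $V=Ru\in\partial D_R$, and $L_\phi$ is its tangent line at $V$; (4) the focus of this parabola is $$J=Ru+R\cot\phi\,v=\Bigl(0,\frac{R}{\sin\phi}\Bigr)$$ (the last pair in the original Cartesian coordinates), which lies on the line through the origin perpendicular to the first coordinate axis, i.e. the common latus-rectum line of all the conics $\Gamma_d$.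
   Context: $O$ is the origin of $\mathbb{R}^2$ and $\|\cdot\|$ is the Euclidean norm. For $R>0$, the radial cone projection of the plane onto the open disk $D_R=\{p\in\mathbb{R}^2:\|p\|<R\}$ is $f_R(p)=\dfrac{p}{1+\|p\|/R}$. For $d>0$, $\ell_d$ is the line of points whose first Cartesian coordinate equals $d$. The carrier of an image arc is the complete conic containing that arc. By the (previously known) Self-Directrix Theorem, the carrier $\Gamma_d$ of $f_R(\ell_d)$ is the conic with focus $O$, directrix $\ell_d$, eccentricity $R/d$ and semi-latus rectum $R$. Its focus-side branch, which contains the image arc $f_R(\ell_d)$, has polar equation $$r=\frac{R}{1+(R/d)\cos\theta}$$ over the directions $\theta$ for which the denominator is positive (the focus-side branch is the whole conic when $\Gamma_d$ is an ellipse or a parabola). Every $\Gamma_d$ has focus $O$, axis the first coordinate axis, and semi-latus rectum $R$, so the line of points with first coordinate $0$ is their common latus-rectum line. The normal to a conic at a point is the line through that point perpendicular to the tangent line there. *)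

theory Defs
  imports "HOL-Analysis.Analysis"
begin

definition radial_cone_projection :: "real \<Rightarrow> real^2 \<Rightarrow> real^2" where
  "radial_cone_projection R p = (1 / (1 + norm p / R)) *\<^sub>R p"

definition vertical_line :: "real \<Rightarrow> (real^2) set" where
  "vertical_line d = {p. p $ 1 = d}"

definition line :: "real^2 \<Rightarrow> real^2 \<Rightarrow> (real^2) set" where
  "line a w = {a + t *\<^sub>R w | t. True}"

definition is_line :: "(real^2) set \<Rightarrow> bool" where
  "is_line L \<longleftrightarrow> (\<exists>a w. w \<noteq> 0 \<and> L = line a w)"

text \<open>Complete, non-degenerate real conics (both branches in the case of a hyperbola): the
  non-empty zero sets of quadratic polynomials whose 3-by-3 symmetric matrix is invertible.\<close>

definition is_conic :: "(real^2) set \<Rightarrow> bool" where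
  "is_conic C \<longleftrightarrow> C \<noteq> {} \<and>
    (\<exists>a b c d e f :: real.
      det (vector [vector [a, b, d], vector [b, c, e], vector [d, e, f]] :: real^3^3) \<noteq> 0 \<and>
      C = {p. a * (p$1)^2 + 2 * b * p$1 * p$2 + c * (p$2)^2 + 2 * d * p$1 + 2 * e * p$2 + f = 0})"

definition carrier_conic :: "(real^2) set \<Rightarrow> (real^2) set" where
  "carrier_conic A = (THE C. is_conic C \<and> A \<subseteq> C)"

definition Gamma_conic :: "real \<Rightarrow> real \<Rightarrow> (real^2) set" where
  "Gamma_conic R d = carrier_conic (radial_cone_projection R ` vertical_line d)"

definition focus_directrix_conic ::
    "(real^2) set \<Rightarrow> real^2 \<Rightarrow> (real^2) set \<Rightarrow> real \<Rightarrow> bool" where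
  "focus_directrix_conic C F D e \<longleftrightarrow>
    is_line D \<and> F \<notin> D \<and> e > 0 \<and> C = {p. dist p F = e * infdist p D}"

text \<open>A central conic has two foci, hence two latus-rectum lines; the argument \<open>F\<close> selects the
  focus. The line is the parallel to the directrix through \<open>F\<close>.\<close>

definition is_latus_rectum_line :: "(real^2) set \<Rightarrow> real^2 \<Rightarrow> (real^2) set \<Rightarrow> bool" where
  "is_latus_rectum_line C F L \<longleftrightarrow>
    (\<exists>D e. focus_directrix_conic C F D e \<and> L = {F + (x - y) | x y. x \<in> D \<and> y \<in> D})"

definition is_parabola :: "(real^2) set \<Rightarrow> bool" where
  "is_parabola C \<longleftrightarrow> (\<exists>F D. focus_directrix_conic C F D 1)"

definition parabola_focus :: "(real^2) set \<Rightarrow> real^2" where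
  "parabola_focus C = (THE F. \<exists>D. focus_directrix_conic C F D 1)"

text \<open>The vertex is the point of the parabola on its axis, the perpendicular to the directrix
  through the focus.\<close>

definition parabola_vertex :: "(real^2) set \<Rightarrow> real^2" where
  "parabola_vertex C = (THE p. p \<in> C \<and>
    (\<exists>F D. focus_directrix_conic C F D 1 \<and> (\<forall>x\<in>D. \<forall>y\<in>D. (p - F) \<bullet> (x - y) = 0)))"

text \<open>The tangent line at \<open>p\<close> is spanned by the non-zero velocity at \<open>p\<close> of a curve running in
  \<open>C\<close> near \<open>p\<close>; on a non-degenerate conic it is unique at every point.\<close>

definition is_tangent_line :: "(real^2) set \<Rightarrow> real^2 \<Rightarrow> (real^2) set \<Rightarrow> bool" where
  "is_tangent_line C p L \<longleftrightarrow>
    (\<exists>(\<gamma> :: real \<Rightarrow> real^2) w. \<gamma> 0 = p \<and> (\<forall>\<^sub>F t in nhds 0. \<gamma> t \<in> C) \<and>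
      (\<gamma> has_vector_derivative w) (at 0) \<and> w \<noteq> 0 \<and> L = line p w)"

definition tangent_line :: "(real^2) set \<Rightarrow> real^2 \<Rightarrow> (real^2) set" where
  "tangent_line C p = (THE L. is_tangent_line C p L)"

definition normal_line :: "(real^2) set \<Rightarrow> real^2 \<Rightarrow> (real^2) set" where
  "normal_line C p = {x. \<forall>y \<in> tangent_line C p. (x - p) \<bullet> (y - p) = 0}"

text \<open>The points of \<open>Gamma_conic R d\<close> on the same side of the directrix \<open>vertical_line d\<close> as the
  focus, the origin.\<close>

definition focus_branch :: "real \<Rightarrow> real \<Rightarrow> (real^2) set" where
  "focus_branch R d = {p \<in> Gamma_conic R d. p $ 1 < d}"

definition open_ray :: "real^2 \<Rightarrow> (real^2) set" where
  "open_ray u = {r *\<^sub>R u | r. r > 0}"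

definition P_point :: "real \<Rightarrow> real^2 \<Rightarrow> real \<Rightarrow> real^2" where
  "P_point R u d = (THE p. p \<in> open_ray u \<inter> focus_branch R d)"

definition N_line :: "real \<Rightarrow> real^2 \<Rightarrow> real \<Rightarrow> (real^2) set" where
  "N_line R u d = normal_line (Gamma_conic R d) (P_point R u d)"


lemma image_arc_subset:
  assumes "R > 0" "d > 0"
  shows "radial_cone_projection R ` vertical_line d \<subseteq> {p. norm p = (R / d) * \<bar>p$1 - d\<bar>}"
proof (clarsimp simp: vertical_line_def)
  fix p :: "real^2"
  define s where "s = norm p"
  have s: "s \<ge> 0" by (simp add: s_def)
  have f: "1 + s / R > 0" using s assms by (simp add: add_pos_nonneg)
  have "norm (radial_cone_projection R p) = s * R / (R + s)"
    using s assms f by (simp add: radial_cone_projection_def s_def[symmetric] field_simps)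
  moreover have "p$1 / (1 + s/R) - p$1 = - (p$1 * s / (R + s))"
    using s assms f by (simp add: divide_simps) (simp add: algebra_simps)
  moreover assume "d = p$1"
  ultimately show "norm (radial_cone_projection R p)
      = R * \<bar>radial_cone_projection R p $ 1 - p$1\<bar> / p$1"
    using s assms by (simp add: radial_cone_projection_def s_def[symmetric] abs_mult)
qed

lemma focus_directrix_equation:
  assumes "R > 0" "d > 0"
  shows "norm (p::real^2) = (R / d) * \<bar>p$1 - d\<bar> \<longleftrightarrow>
    (1 - R^2 / d^2) * (p$1)^2 + (p$2)^2 + 2 * (R^2 / d) * p$1 - R^2 = 0"
proof -
  have n: "norm p ^ 2 = (p$1)^2 + (p$2)^2"
    by (simp add: norm_vec_def L2_set_def sum_2)
  have "norm p = (R / d) * \<bar>p$1 - d\<bar> \<longleftrightarrow> norm p ^ 2 = ((R / d) * \<bar>p$1 - d\<bar>)^2"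
    using assms by (simp add: power2_eq_iff_nonneg)
  also have "((R / d) * \<bar>p$1 - d\<bar>)^2 = R^2 / d^2 * (p$1)^2 - 2 * (R^2/d) * p$1 + R^2"
    using assms by (simp add: power_mult_distrib power2_diff) (simp add: field_simps power2_eq_square)
  finally show ?thesis unfolding n by (auto simp: algebra_simps)
qed

lemma conic_through_arc:
  fixes A B C D E F R d :: real
  assumes R: "R > 0" and d: "d > 0"
    and sub: "radial_cone_projection R ` vertical_line d \<subseteq>
      {p. A * (p$1)^2 + 2 * B * p$1 * p$2 + C * (p$2)^2 + 2 * D * p$1 + 2 * E * p$2 + F = 0}"
  shows "B = 0 \<and> E = 0 \<and> A = C * (1 - R^2/d^2) \<and> D = C * (R^2/d) \<and> F = - C * R^2"
proof -
  have eq: "A*d^2 + 2*B*d*y + C*y^2 + 2*D*d*(1+s/R) + 2*E*y*(1+s/R) + F*(1+s/R)^2 = 0"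
    if s: "s^2 = d^2 + y^2" "s > 0" for s y
  proof -
    have nm: "norm (vector [d,y] :: real^2) = s"
      using s by (simp add: norm_vec_def L2_set_def sum_2 real_sqrt_unique)
    define m where "m = 1 + s / R"
    have m: "m > 0" using s R by (simp add: m_def add_pos_pos)
    have "vector [d,y] \<in> vertical_line d" by (simp add: vertical_line_def)
    with sub have "A*(d/m)^2 + 2*B*(d/m)*(y/m) + C*(y/m)^2 + 2*D*(d/m) + 2*E*(y/m) + F = 0"
      unfolding image_subset_iff by (auto simp: radial_cone_projection_def nm m_def dest!: bspec)
    then have "m^2 * (A*(d/m)^2 + 2*B*(d/m)*(y/m) + C*(y/m)^2 + 2*D*(d/m) + 2*E*(y/m) + F) = 0"
      by simp
    also have "m^2 * (A*(d/m)^2 + 2*B*(d/m)*(y/m) + C*(y/m)^2 + 2*D*(d/m) + 2*E*(y/m) + F)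
      = A*d^2 + 2*B*d*y + C*y^2 + 2*D*d*m + 2*E*y*m + F*m^2"
      using m by (simp add: field_simps power2_eq_square)
    finally show ?thesis unfolding m_def .
  qed
  have both: "B*d + E*(1+s/R) = 0 \<and>
      A*d^2 + C*(s^2-d^2) + 2*D*d*(1+s/R) + F*(1+s/R)^2 = 0" if "s > d" for s
  proof -
    define y where "y = sqrt (s^2 - d^2)"
    have sd: "s^2 > d^2" using that d by (simp add: power_strict_mono)
    then have y: "y > 0" "y^2 = s^2 - d^2" by (auto simp: y_def)
    have e1: "A*d^2 + 2*B*d*y + C*y^2 + 2*D*d*(1+s/R) + 2*E*y*(1+s/R) + F*(1+s/R)^2 = 0"
      by (rule eq) (use y that d in auto)
    have e2: "A*d^2 + 2*B*d*(-y) + C*(-y)^2 + 2*D*d*(1+s/R) + 2*E*(-y)*(1+s/R) + F*(1+s/R)^2 = 0"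
      by (rule eq) (use y that d in auto)
    define m where "m = 1 + s/R"
    have "4 * y * (B*d + E*m) = (A*d^2 + 2*B*d*y + C*y^2 + 2*D*d*m + 2*E*y*m + F*m^2)
        - (A*d^2 + 2*B*d*(-y) + C*(-y)^2 + 2*D*d*m + 2*E*(-y)*m + F*m^2)"
      by (simp add: algebra_simps)
    also have "\<dots> = 0" using e1 e2 by (simp add: m_def)
    finally have o: "B*d + E*m = 0" using y by simp
    have "A*d^2 + C*y^2 + 2*D*d*m + F*m^2
        = (A*d^2 + 2*B*d*y + C*y^2 + 2*D*d*m + 2*E*y*m + F*m^2) - 2*y*(B*d + E*m)"
      by (simp add: algebra_simps)
    also have "\<dots> = 0" using e1 o by (simp add: m_def)
    finally show ?thesis using o y by (simp add: m_def)
  qed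
  note b = both[of "2*d"] both[of "3*d"] both[of "4*d"]
  define k where "k = d / R"
  have k: "k > 0" using R d by (simp add: k_def)
  have o: "B*d + E*(1+2*k) = 0" "B*d + E*(1+3*k) = 0"
    using b d by (auto simp: k_def)
  have "E * k = (B*d + E*(1+3*k)) - (B*d + E*(1+2*k))" by (simp add: algebra_simps)
  then have "E * k = 0" using o by simp
  then have E: "E = 0" using k by simp
  then have B: "B = 0" using o d by simp
  have q: "A*d^2 + C*3*d^2 + 2*D*d*(1+2*k) + F*(1+2*k)^2 = 0"
    "A*d^2 + C*8*d^2 + 2*D*d*(1+3*k) + F*(1+3*k)^2 = 0"
    "A*d^2 + C*15*d^2 + 2*D*d*(1+4*k) + F*(1+4*k)^2 = 0"
    using b d by (auto simp: k_def power2_eq_square algebra_simps)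
  have "2 * (C*d^2 + F*k^2) = (A*d^2 + C*15*d^2 + 2*D*d*(1+4*k) + F*(1+4*k)^2)
      - 2 * (A*d^2 + C*8*d^2 + 2*D*d*(1+3*k) + F*(1+3*k)^2)
      + (A*d^2 + C*3*d^2 + 2*D*d*(1+2*k) + F*(1+2*k)^2)"
    by (simp add: algebra_simps power2_eq_square)
  then have c2: "C*d^2 + F*k^2 = 0" using q by simp
  have "F * k^2 = - (C*R^2) * k^2" using c2 R by (simp add: k_def power_divide)
  then have "(F + C*R^2) * k^2 = 0" by (simp add: algebra_simps)
  then have F: "F = - C * R^2" using k by simp
  have "2*k*(D*d + F) = (A*d^2 + C*8*d^2 + 2*D*d*(1+3*k) + F*(1+3*k)^2)
      - (A*d^2 + C*3*d^2 + 2*D*d*(1+2*k) + F*(1+2*k)^2) - 5 * (C*d^2 + F*k^2)"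
    by (simp add: algebra_simps power2_eq_square)
  then have "2*k*(D*d + F) = 0" using q c2 by simp
  then have Dd: "D*d + F = 0" using k by simp
  then have D: "D = C * (R^2/d)" using d F by (simp add: field_simps)
  have "A*d^2 - C*d^2 + 2*D*d + F = 0"
  proof -
    have "A*d^2 - C*d^2 + 2*D*d + F = (A*d^2 + C*3*d^2 + 2*D*d*(1+2*k) + F*(1+2*k)^2)
      - 4*(C*d^2 + F*k^2) - 4*k*(D*d+F)" by (simp add: algebra_simps power2_eq_square)
    then show ?thesis using q c2 Dd by simp
  qed
  then have "A*d^2 = C*d^2 - C*R^2" using Dd F by simp
  then have "A = C * (1 - R^2/d^2)" using d by (simp add: field_simps)
  then show ?thesis using B E D F by simp
qed


lemma self_directrix:
  assumes R: "R > 0" and d: "d > 0"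
  shows "Gamma_conic R d = {p. norm p = (R / d) * \<bar>p$1 - d\<bar>}" (is "_ = ?G")
  unfolding Gamma_conic_def carrier_conic_def
proof (rule the_equality)
  have G: "?G = {p. (1 - R^2/d^2) * (p$1)^2 + 2 * 0 * p$1 * p$2 + 1 * (p$2)^2
      + 2 * (R^2/d) * p$1 + 2 * 0 * p$2 + - (R^2) = 0}"
    using focus_directrix_equation[OF R d] by auto
  have sub: "radial_cone_projection R ` vertical_line d \<subseteq> ?G"
    by (rule image_arc_subset[OF R d])
  have "vector [d,0] \<in> vertical_line d" by (simp add: vertical_line_def)
  then have "?G \<noteq> {}" using sub by blast
  moreover have "det (vector [vector [1 - R^2/d^2, 0, R^2/d], vector [0, 1, 0],
      vector [R^2/d, 0, - (R^2)]] :: real^3^3) \<noteq> 0"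
  proof -
    have "- ((1 - R^2/d^2) * R^2) - R^2/d * (R^2/d) = - (R^2)"
      using d by (simp add: field_simps power2_eq_square)
    then show ?thesis using R by (simp add: det_3)
  qed
  ultimately show "is_conic ?G \<and> radial_cone_projection R ` vertical_line d \<subseteq> ?G"
    unfolding is_conic_def using sub G by blast
next
  fix K assume "is_conic K \<and> radial_cone_projection R ` vertical_line d \<subseteq> K"
  then obtain a b c d' e f where
    det: "det (vector [vector [a, b, d'], vector [b, c, e], vector [d', e, f]] :: real^3^3) \<noteq> 0"
    and K: "K = {p. a * (p$1)^2 + 2 * b * p$1 * p$2 + c * (p$2)^2
        + 2 * d' * p$1 + 2 * e * p$2 + f = 0}"
    and sub: "radial_cone_projection R ` vertical_line d \<subseteq> K"
    unfolding is_conic_def by blast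
  have co: "b = 0" "e = 0" "a = c * (1 - R^2/d^2)" "d' = c * (R^2/d)" "f = - c * R^2"
    using conic_through_arc[OF R d sub[unfolded K]] by auto
  have c: "c \<noteq> 0" using det co by (auto simp: det_3)
  have "a * x^2 + 2 * b * x * y + c * y^2 + 2 * d' * x + 2 * e * y + f
      = c * ((1 - R^2/d^2) * x^2 + y^2 + 2 * (R^2/d) * x - R^2)" for x y
    unfolding co by (simp add: algebra_simps)
  then show "K = ?G" unfolding K using focus_directrix_equation[OF R d] c by auto
qed

lemma focus_branch_polar:
  assumes R: "R > 0" and d: "d > 0"
  shows "focus_branch R d = {r *\<^sub>R vector [cos \<theta>, sin \<theta>] | r \<theta>.
    1 + (R / d) * cos \<theta> > 0 \<and> r = R / (1 + (R / d) * cos \<theta>)}"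
proof (rule set_eqI, rule iffI)
  fix p assume "p \<in> focus_branch R d"
  then have n: "norm p = (R/d) * (d - p$1)" and lt: "p$1 < d"
    by (auto simp: focus_branch_def self_directrix[OF R d])
  then have pos: "norm p > 0" using R d by simp
  define r where "r = norm p"
  have "(p$1/r)^2 + (p$2/r)^2 = 1"
  proof -
    have rr: "r^2 = (p$1)^2 + (p$2)^2"
      by (simp add: r_def norm_vec_def L2_set_def sum_2)
    have "(p$1/r)^2 + (p$2/r)^2 = ((p$1)^2 + (p$2)^2) / r^2"
      by (simp add: power_divide add_divide_distrib)
    also have "\<dots> = r^2 / r^2" by (simp add: rr)
    also have "\<dots> = 1" using pos by (simp add: r_def)
    finally show ?thesis .
  qed
  then obtain t where t: "p$1/r = cos t" "p$2/r = sin t" using sincos_total_2pi by metis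
  have r: "r > 0" using pos r_def by simp
  then have p1: "p$1 = r * cos t" "p$2 = r * sin t" using t by (auto simp: field_simps)
  then have p: "p = r *\<^sub>R vector [cos t, sin t]" by (simp add: vec_eq_iff forall_2)
  have "r * (1 + (R/d) * cos t) = R" using n d p1 by (simp add: r_def[symmetric] field_simps)
  moreover from this have pos': "1 + (R/d) * cos t > 0" using r R by (metis zero_less_mult_pos)
  ultimately have "r = R / (1 + (R/d) * cos t)" by (simp add: nonzero_eq_divide_eq)
  with pos' p show "p \<in> {r *\<^sub>R vector [cos \<theta>, sin \<theta>] | r \<theta>.
    1 + (R / d) * cos \<theta> > 0 \<and> r = R / (1 + (R / d) * cos \<theta>)}"
    by blast
next
  fix p :: "real^2"
  assume "p \<in> {r *\<^sub>R vector [cos \<theta>, sin \<theta>] | r \<theta>.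
    1 + (R / d) * cos \<theta> > 0 \<and> r = R / (1 + (R / d) * cos \<theta>)}"
  then obtain r t where p: "p = r *\<^sub>R vector [cos t, sin t]"
    and pos: "1 + (R/d) * cos t > 0" and r: "r = R / (1 + (R/d) * cos t)" by blast
  have r0: "r > 0" using r pos R by simp
  have "r * (1 + (R/d) * cos t) = R" using r pos by simp
  then have re: "r = (R/d) * (d - r * cos t)" using d by (simp add: field_simps)
  have "norm (vector [cos t, sin t] :: real^2) = 1"
    by (simp add: norm_vec_def L2_set_def sum_2)
  then have "norm p = r" using r0 by (simp add: p)
  moreover have "d - r * cos t > 0"
    using re r0 R d by (metis divide_pos_pos zero_less_mult_pos)
  ultimately show "p \<in> focus_branch R d"
    using re by (simp add: focus_branch_def self_directrix[OF R d] p)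
qed

end

theory Submission
  imports Defs
begin

text \<open>Why the theorem holds. Write \<open>e = R / d\<close>. On the focus-side branch the point in direction
  \<open>\<phi>\<close> has distance \<open>r = R / (1 + e cos \<phi>)\<close> from the focus, and differentiating the polar equation
  gives a tangent vector proportional to \<open>k u + v\<close> there, where \<open>k = e r sin \<phi> / R\<close>. By the
  polar equation \<open>e r cos \<phi> = R - r\<close>, so that \<open>k = tan \<phi> (R - r) / R\<close> depends on \<open>d\<close> only
  through \<open>r\<close>. In rotated coordinates the normal is therefore the line
  \<open>\<eta> = (tan \<phi> / R) (R - r) (r - \<xi>)\<close> (\<open>N_line_eq\<close>), whose coefficients are quadratic in \<open>r\<close>;
  its envelope is found by comparing it with the tangent lines of the parabola.

  The tangent of \<open>\<eta> = a (\<xi> - R)\<^sup>2\<close>, \<open>a = tan \<phi> / (4 R)\<close>, at abscissa \<open>s\<close> has slope \<open>2 a (s - R)\<close>.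
  Both lines are graphs over the \<open>\<xi>\<close>-axis, so they agree exactly when slopes and intercepts agree:
  equality of slopes forces \<open>s = 2 r - R\<close>, and then the intercepts agree as well
  (\<open>N_line_eq_tangent_iff\<close>). As \<open>d\<close> runs over the positive reals, \<open>r\<close> takes every value in
  \<open>(0, R)\<close> and no other (\<open>polar_radius_range\<close>), so the abscissae of tangency fill \<open>(-R, R)\<close>.

  The focus and the vertex are those of the focus-directrix description of the parabola. They are
  well defined because a parabola determines its focus and directrix: substituting a
  parametrization into the focus-directrix equation yields a quartic polynomial that vanishes
  identically, and its coefficients fix both (\<open>focus_directrix_unique_frame_parabola\<close>). The focus lies
  on the common latus-rectum line because \<open>1 / (4 a) = R cot \<phi>\<close>, which makes the first Cartesian
  coordinate \<open>R cos \<phi> - R cot \<phi> sin \<phi>\<close> vanish.\<close>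

section \<open>Plane vectors and lines\<close>

text \<open>The counterclockwise quarter turn. For a unit vector \<open>u\<close> the pair \<open>u\<close>, \<open>perp u\<close> is the rotated
  frame, so the two coordinates of \<open>x\<close> can be written as the inner products \<open>x \<bullet> u\<close> and \<open>x \<bullet> perp u\<close>.\<close>

definition perp :: "real^2 \<Rightarrow> real^2" where
  "perp w = vector [- w$2, w$1]"

lemma inner_vec2: "x \<bullet> y = x$1 * y$1 + x$2 * y$2" for x y :: "real^2"
  by (simp add: inner_vec_def sum_2)

lemma perp_perp [simp]: "perp (perp w) = - w"
  by (simp add: perp_def vec_eq_iff forall_2)

lemma perp_add: "perp (x + y) = perp x + perp y"
  by (simp add: perp_def vec_eq_iff forall_2)

lemma perp_scaleR: "perp (c *\<^sub>R x) = c *\<^sub>R perp x"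
  by (simp add: perp_def vec_eq_iff forall_2)

lemma inner_perp_self [simp]: "w \<bullet> perp w = 0" "perp w \<bullet> w = 0"
  by (simp_all add: inner_vec2 perp_def)

lemma inner_perp_perp [simp]: "perp x \<bullet> perp y = x \<bullet> y"
  by (simp add: inner_vec2 perp_def)

lemma norm_perp [simp]: "norm (perp w) = norm w"
  by (simp add: norm_eq_sqrt_inner)

lemma perp_eq_0_iff [simp]: "perp w = 0 \<longleftrightarrow> w = 0"
  by (metis norm_eq_zero norm_perp)

text \<open>Orthogonal decomposition without division: clearing the denominator \<open>w \<bullet> w\<close> keeps the identity
  polynomial in the coordinates.\<close>

lemma perp_expansion: "(w \<bullet> w) *\<^sub>R x = (x \<bullet> w) *\<^sub>R w + (x \<bullet> perp w) *\<^sub>R perp w"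
  by (simp add: inner_vec2 perp_def vec_eq_iff forall_2 algebra_simps)

lemma frame_expansion:
  assumes "norm u = 1"
  shows "x = (x \<bullet> u) *\<^sub>R u + (x \<bullet> perp u) *\<^sub>R perp u"
  using perp_expansion[of u x] assms by (simp add: dot_square_norm)

lemma norm_frame:
  assumes "norm u = 1"
  shows "(norm x)^2 = (x \<bullet> u)^2 + (x \<bullet> perp u)^2"
proof -
  have "(u \<bullet> u) * (x \<bullet> x) = (x \<bullet> u)^2 + (x \<bullet> perp u)^2"
    by (simp add: inner_vec2 perp_def power2_eq_square algebra_simps)
  then show ?thesis using assms by (simp add: dot_square_norm)
qed

lemma line_conv_perp:
  assumes "w \<noteq> 0"
  shows "line a w = {x. (x - a) \<bullet> perp w = 0}"
proof (intro set_eqI iffI)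
  fix x assume "x \<in> {x. (x - a) \<bullet> perp w = 0}"
  then have "(w \<bullet> w) *\<^sub>R (x - a) = ((x - a) \<bullet> w) *\<^sub>R w"
    using perp_expansion[of w "x - a"] by simp
  then have "(1 / (w \<bullet> w)) *\<^sub>R ((w \<bullet> w) *\<^sub>R (x - a))
      = (1 / (w \<bullet> w)) *\<^sub>R (((x - a) \<bullet> w) *\<^sub>R w)" by simp
  then have "x - a = (((x - a) \<bullet> w) / (w \<bullet> w)) *\<^sub>R w" using assms by simp
  then have "x = a + (((x - a) \<bullet> w) / (w \<bullet> w)) *\<^sub>R w" by (metis add.commute diff_add_cancel)
  then show "x \<in> line a w" unfolding line_def by blast
qed (auto simp: line_def)

lemma line_scaleR:
  assumes "c \<noteq> 0" "w \<noteq> 0"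
  shows "line a (c *\<^sub>R w) = line a w"
  using assms by (simp add: line_conv_perp perp_scaleR)

text \<open>A unit normal makes the distance to the line linear up to an absolute value, which is what turns
  focus-directrix conditions into polynomial equations.\<close>

lemma is_line_normal_form:
  "is_line D \<longleftrightarrow> (\<exists>n c. norm n = 1 \<and> D = {x. x \<bullet> n = c})"
proof
  assume "is_line D"
  then obtain a w where w: "w \<noteq> 0" "D = line a w" by (auto simp: is_line_def)
  define n where "n = (1 / norm w) *\<^sub>R perp w"
  have "norm n = 1" using w by (simp add: n_def)
  moreover have "D = {x. x \<bullet> n = a \<bullet> n}"
    using w by (auto simp: line_conv_perp n_def inner_diff_left)
  ultimately show "\<exists>n c. norm n = 1 \<and> D = {x. x \<bullet> n = c}" by blast
next
  assume "\<exists>n c. norm n = 1 \<and> D = {x. x \<bullet> n = c}"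
  then obtain n c where n: "norm n = 1" "D = {x. x \<bullet> n = c}" by blast
  have "n \<noteq> 0" using n by auto
  moreover have "D = line (c *\<^sub>R n) (perp n)"
    using n \<open>n \<noteq> 0\<close> by (auto simp: line_conv_perp inner_diff_left dot_square_norm)
  ultimately show "is_line D" unfolding is_line_def by (metis perp_eq_0_iff)
qed

text \<open>The foot of the perpendicular realizes the distance; no point is nearer by the Cauchy-Schwarz
  inequality.\<close>

lemma infdist_hyperplane:
  fixes n :: "'a::euclidean_space"
  assumes n: "norm n = 1"
  shows "infdist p {x. x \<bullet> n = c} = \<bar>p \<bullet> n - c\<bar>"
proof (rule antisym)
  define q where "q = p - (p \<bullet> n - c) *\<^sub>R n"
  have q: "q \<in> {x. x \<bullet> n = c}"
    using n by (simp add: q_def inner_diff_left dot_square_norm)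
  have "dist p q = \<bar>p \<bullet> n - c\<bar>" using n by (simp add: q_def dist_norm)
  then show "infdist p {x. x \<bullet> n = c} \<le> \<bar>p \<bullet> n - c\<bar>" using infdist_le[OF q, of p] by simp
  show "\<bar>p \<bullet> n - c\<bar> \<le> infdist p {x. x \<bullet> n = c}"
  proof -
    have "\<bar>p \<bullet> n - c\<bar> \<le> dist p x" if "x \<bullet> n = c" for x
      using Cauchy_Schwarz_ineq2[of "p - x" n] that n by (simp add: inner_diff_left dist_norm)
    then show ?thesis using q by (auto simp: infdist_def intro!: cINF_greatest)
  qed
qed

section \<open>Tangent and normal lines of plane curves\<close>

text \<open>The velocity of any curve on which \<open>F\<close> vanishes lies in the kernel of the derivative of \<open>F\<close>. In the
  plane that kernel has dimension one as soon as the derivative is nonzero, and it contains \<open>w\<close>; so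
  every admissible velocity is a multiple of \<open>w\<close>. Since \<open>w\<close> lies in the kernel, nonvanishing of the
  derivative can be tested on \<open>perp w\<close>.\<close>

lemma tangent_line_eqI:
  fixes F :: "real^2 \<Rightarrow> real"
  assumes curve: "\<gamma> 0 = p" "\<forall>\<^sub>F t in nhds 0. \<gamma> t \<in> C" "(\<gamma> has_vector_derivative w) (at 0)"
    and w: "w \<noteq> 0"
    and F: "(F has_derivative F') (at p)" and zero: "\<And>x. x \<in> C \<Longrightarrow> F x = 0"
    and transversal: "F' (perp w) \<noteq> 0"
  shows "tangent_line C p = line p w"
proof -
  have lin: "linear F'" using F by (rule has_derivative_linear)
  have kernel: "F' z = 0"
    if c: "\<delta> 0 = p" "\<forall>\<^sub>F t in nhds 0. \<delta> t \<in> C" "(\<delta> has_vector_derivative z) (at 0)" for \<delta> z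
  proof -
    have "((F \<circ> \<delta>) has_vector_derivative F' z) (at 0)"
      using F c by (intro vector_derivative_diff_chain_within) (auto intro: has_derivative_at_withinI)
    moreover have "\<forall>\<^sub>F t in nhds 0. (F \<circ> \<delta>) t = 0"
      using c(2) by eventually_elim (simp add: zero)
    then obtain S where "open S" "0 \<in> S" "\<And>t. t \<in> S \<Longrightarrow> (F \<circ> \<delta>) t = 0"
      by (auto simp: eventually_nhds)
    ultimately have "((\<lambda>_. 0) has_vector_derivative F' z) (at 0)"
      by (rule has_vector_derivative_transform_within_open)
    then show ?thesis
      using vector_derivative_unique_at[OF _ has_vector_derivative_const] by blast
  qed
  have "is_tangent_line C p (line p w)"
    unfolding is_tangent_line_def using curve w by blast
  moreover have "K = line p w" if tangent: "is_tangent_line C p K" for K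
  proof -
    obtain \<delta> z where d: "\<delta> 0 = p" "\<forall>\<^sub>F t in nhds 0. \<delta> t \<in> C"
      "(\<delta> has_vector_derivative z) (at 0)" and z: "z \<noteq> 0" "K = line p z"
      using tangent unfolding is_tangent_line_def by (elim exE conjE) (rule that)
    have "F' ((w \<bullet> w) *\<^sub>R z) = F' ((z \<bullet> w) *\<^sub>R w + (z \<bullet> perp w) *\<^sub>R perp w)"
      by (rule arg_cong[OF perp_expansion])
    then have "(w \<bullet> w) * F' z = (z \<bullet> w) * F' w + (z \<bullet> perp w) * F' (perp w)"
      by (simp only: linear_add[OF lin] linear_cmul[OF lin] real_scaleR_def)
    then have "z \<bullet> perp w = 0"
      using kernel[OF d] kernel[OF curve] transversal by simp
    then have "p + z \<in> line p w" using w by (simp add: line_conv_perp)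
    then obtain c where c: "z = c *\<^sub>R w" unfolding line_def by auto
    then have "c \<noteq> 0" using z(1) by auto
    then show ?thesis unfolding z(2) c using w by (rule line_scaleR)
  qed
  ultimately show ?thesis unfolding tangent_line_def by (rule the_equality)
qed

lemma normal_line_eq:
  assumes "tangent_line C p = line p w"
  shows "normal_line C p = {x. (x - p) \<bullet> w = 0}"
proof -
  have "(\<forall>y\<in>line p w. (x - p) \<bullet> (y - p) = 0) \<longleftrightarrow> (x - p) \<bullet> w = 0" for x
    by (force simp: line_def)
  then show ?thesis by (simp add: normal_line_def assms)
qed

section \<open>Parabolas in a rotated frame\<close>

text \<open>In the frame \<open>u\<close>, \<open>perp u\<close> this is the parabola \<open>\<eta> = a (\<xi> - h)\<^sup>2\<close>. Describing it by inner
  products avoids existential coordinates.\<close>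

definition frame_parabola :: "real^2 \<Rightarrow> real \<Rightarrow> real \<Rightarrow> (real^2) set" where
  "frame_parabola u h a = {x. x \<bullet> perp u = a * (x \<bullet> u - h)^2}"

lemma tangent_line_frame_parabola:
  assumes u: "norm u = 1" and q: "q \<in> frame_parabola u h a"
  shows "tangent_line (frame_parabola u h a) q =
    {x. x \<bullet> perp u = 2 * a * (q \<bullet> u - h) * (x \<bullet> u) - a * ((q \<bullet> u)^2 - h^2)}"
proof -
  define s where "s = q \<bullet> u"
  define m where "m = 2 * a * (s - h)"
  define w where "w = u + m *\<^sub>R perp u"
  define \<gamma> where "\<gamma> t = (s + t) *\<^sub>R u + (a * (s + t - h)^2) *\<^sub>R perp u" for t
  have uu: "u \<bullet> u = 1" using u by (simp add: dot_square_norm)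
  have qe: "q \<bullet> perp u = a * (s - h)^2" using q by (simp add: frame_parabola_def s_def)
  have 1: "\<gamma> 0 = q"
    using frame_expansion[OF u, of q] qe by (simp add: \<gamma>_def s_def[symmetric])
  have 2: "\<gamma> t \<in> frame_parabola u h a" for t
    by (simp add: \<gamma>_def frame_parabola_def inner_add_left uu)
  have 3: "(\<gamma> has_vector_derivative w) (at 0)"
    unfolding \<gamma>_def w_def m_def
    by (auto intro!: derivative_eq_intros simp: has_real_derivative_iff_has_vector_derivative[symmetric])
  have pw: "perp w = perp u - m *\<^sub>R u"
    by (simp add: w_def perp_add perp_scaleR)
  have "w \<bullet> u = 1" by (simp add: w_def inner_add_left uu)
  then have w: "w \<noteq> 0" by auto
  have "tangent_line (frame_parabola u h a) q = line q w"
  proof (rule tangent_line_eqI[where \<gamma> = \<gamma>, OF 1 _ 3 w])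
    show "((\<lambda>x. x \<bullet> perp u - a * (x \<bullet> u - h)^2) has_derivative
        (\<lambda>k. k \<bullet> perp u - m * (k \<bullet> u))) (at q)"
      by (auto intro!: derivative_eq_intros simp: m_def s_def fun_eq_iff)
    have "perp w \<bullet> perp u - m * (perp w \<bullet> u) = 1 + m * m"
      by (simp add: pw inner_diff_left uu)
    moreover have "1 + m * m > 0" by (simp add: add_pos_nonneg)
    ultimately show "perp w \<bullet> perp u - m * (perp w \<bullet> u) \<noteq> 0" by simp
  qed (auto simp: 2, auto simp: frame_parabola_def)
  moreover have "(x - q) \<bullet> perp w = 0 \<longleftrightarrow>
      x \<bullet> perp u = m * (x \<bullet> u) - a * (s^2 - h^2)" for x
  proof -
    have "(x - q) \<bullet> perp w = x \<bullet> perp u - m * (x \<bullet> u) - (q \<bullet> perp u - m * s)"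
      by (simp add: pw inner_diff_right inner_diff_left s_def algebra_simps)
    also have "q \<bullet> perp u - m * s = - (a * (s^2 - h^2))"
      by (simp add: qe m_def power2_eq_square algebra_simps)
    finally show ?thesis by auto
  qed
  ultimately show ?thesis using line_conv_perp[OF w] by (simp add: m_def s_def)
qed

text \<open>Two such graphs that coincide have equal ordinates at the abscissae 0 and 1.\<close>

lemma frame_line_eq_iff:
  assumes u: "norm u = 1"
  shows "{x. x \<bullet> perp u = m * (x \<bullet> u) + c} = {x. x \<bullet> perp u = m' * (x \<bullet> u) + c'}
    \<longleftrightarrow> m = m' \<and> c = c'" (is "?A = ?B \<longleftrightarrow> _")
proof
  assume eq: "?A = ?B"
  have uu: "u \<bullet> u = 1" using u by (simp add: dot_square_norm)
  have "t *\<^sub>R u + (m * t + c) *\<^sub>R perp u \<in> ?A" for t by (simp add: inner_add_left uu)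
  then have "t *\<^sub>R u + (m * t + c) *\<^sub>R perp u \<in> ?B" for t using eq by blast
  then have "m * t + c = m' * t + c'" for t by (simp add: inner_add_left uu)
  from this[of 0] this[of 1] show "m = m' \<and> c = c'" by simp
qed auto

lemma focus_directrix_frame_parabola:
  assumes u: "norm u = 1" and a: "a \<noteq> 0"
  shows "focus_directrix_conic (frame_parabola u h a) (h *\<^sub>R u + (1 / (4 * a)) *\<^sub>R perp u)
    {x. x \<bullet> perp u = - 1 / (4 * a)} 1" (is "focus_directrix_conic _ ?F ?D 1")
proof -
  have uu: "u \<bullet> u = 1" using u by (simp add: dot_square_norm)
  have "is_line ?D" unfolding is_line_normal_form using u by (metis norm_perp)
  moreover have "?F \<notin> ?D" using a by (simp add: inner_add_left uu field_simps)
  moreover have "x \<bullet> perp u = a * (x \<bullet> u - h)^2 \<longleftrightarrow> dist x ?F = infdist x ?D" for x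
  proof -
    define s where "s = x \<bullet> u - h"
    define y where "y = x \<bullet> perp u"
    define k where "k = 1 / (4 * a)"
    have k: "4 * a * k = 1" using a by (simp add: k_def)
    have D: "infdist x ?D = \<bar>y + k\<bar>"
      using u by (simp add: infdist_hyperplane y_def k_def)
    have "(dist x ?F)^2 = s^2 + (y - k)^2"
      unfolding dist_norm norm_frame[OF u]
      by (simp add: inner_add_left inner_diff_left uu s_def y_def k_def)
    then have "dist x ?F = infdist x ?D \<longleftrightarrow> s^2 + (y - k)^2 = (y + k)^2"
      unfolding D by (metis abs_ge_zero power2_abs power2_eq_iff_nonneg zero_le_dist)
    also have "\<dots> \<longleftrightarrow> s^2 = 4 * k * y" by (auto simp: power2_eq_square algebra_simps)
    also have "\<dots> \<longleftrightarrow> a * s^2 = a * (4 * k * y)" using a by simp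
    also have "a * (4 * k * y) = y" using k by (simp add: algebra_simps)
    finally show ?thesis by (auto simp: s_def y_def)
  qed
  ultimately show ?thesis by (auto simp: focus_directrix_conic_def frame_parabola_def)
qed

text \<open>Five sample points determine a quartic; at \<open>0, \<plusminus>1, \<plusminus>2\<close> the even and the odd coefficients
  separate into two linear systems.\<close>

lemma quartic_vanishes:
  fixes c0 c1 c2 c3 c4 :: real
  assumes "\<And>t. c0 + c1 * t + c2 * t^2 + c3 * t^3 + c4 * t^4 = 0"
  shows "c0 = 0 \<and> c1 = 0 \<and> c2 = 0 \<and> c3 = 0 \<and> c4 = 0"
proof -
  have c0: "c0 = 0" using assms[of 0] by simp
  have p: "c1 + c2 + c3 + c4 = 0" "- c1 + c2 - c3 + c4 = 0"
    "2 * c1 + 4 * c2 + 8 * c3 + 16 * c4 = 0" "- 2 * c1 + 4 * c2 - 8 * c3 + 16 * c4 = 0"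
    using assms[of 1] assms[of "-1"] assms[of 2] assms[of "-2"] c0 by simp_all
  have "c2 + c4 = 0" using p(1,2) by linarith
  moreover have "c2 + 4 * c4 = 0" using p(3,4) by linarith
  moreover have "c1 + c3 = 0" using p(1,2) by linarith
  moreover have "c1 + 4 * c3 = 0" using p(3,4) by linarith
  ultimately show ?thesis using c0 by auto
qed

text \<open>Let \<open>n\<close> be a unit normal of the directrix. Along the point with abscissa \<open>h + t\<close> the squared
  focus-directrix equation is a quartic in \<open>t\<close>. Its leading coefficient makes \<open>n\<close> parallel to
  \<open>perp u\<close>; the linear one puts the focus on the axis; the constant and the quadratic one then place
  focus and directrix at \<open>\<plusminus>1 / (4 a)\<close> from the vertex, on opposite sides.\<close>

lemma focus_directrix_unique_frame_parabola:
  assumes u: "norm u = 1" and a: "a \<noteq> 0"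
    and fd: "focus_directrix_conic (frame_parabola u h a) F D 1"
  shows "F = h *\<^sub>R u + (1 / (4 * a)) *\<^sub>R perp u" and "D = {x. x \<bullet> perp u = - 1 / (4 * a)}"
proof -
  have uu: "u \<bullet> u = 1" using u by (simp add: dot_square_norm)
  obtain n c where n: "norm n = 1" and D: "D = {x. x \<bullet> n = c}"
    using fd by (auto simp: focus_directrix_conic_def is_line_normal_form)
  have on: "(dist x F)^2 = (x \<bullet> n - c)^2" if "x \<in> frame_parabola u h a" for x
    using fd that by (auto simp: focus_directrix_conic_def D infdist_hyperplane[OF n])
  define n1 n2 f g b where "n1 = n \<bullet> u" "n2 = n \<bullet> perp u" "f = F \<bullet> u - h"
    "g = F \<bullet> perp u" "b = c - h * n1"
  note defs = this
  have nn: "n1^2 + n2^2 = 1" using norm_frame[OF u, of n] n by (simp add: defs)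
  have "(f^2 + g^2 - b^2) + (2 * n1 * b - 2 * f) * t + (1 - 2 * a * g - n1^2 + 2 * a * n2 * b) * t^2
      + (- 2 * a * n1 * n2) * t^3 + (a^2 - a^2 * n2^2) * t^4 = 0" for t
  proof -
    define x where "x = (h + t) *\<^sub>R u + (a * t^2) *\<^sub>R perp u"
    have xu: "x \<bullet> u = h + t" "x \<bullet> perp u = a * t^2" by (simp_all add: x_def inner_add_left uu)
    have "x \<in> frame_parabola u h a" by (simp add: frame_parabola_def xu)
    then have "(dist x F)^2 = (x \<bullet> n - c)^2" by (rule on)
    moreover have "(dist x F)^2 = (t - f)^2 + (a * t^2 - g)^2"
      unfolding dist_norm norm_frame[OF u] by (simp add: inner_diff_left xu defs algebra_simps)
    moreover have "x \<bullet> n - c = n1 * t + n2 * (a * t^2) - b"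
      by (simp add: x_def inner_add_left defs inner_commute algebra_simps)
    ultimately have "(t - f)^2 + (a * t^2 - g)^2 - (n1 * t + n2 * (a * t^2) - b)^2 = 0" by simp
    then show ?thesis by (simp add: power2_eq_square power3_eq_cube power4_eq_xxxx algebra_simps)
  qed
  note q = quartic_vanishes[OF this]
  have "a^2 * (1 - n2^2) = 0" using q by (simp add: algebra_simps)
  then have n2: "n2^2 = 1" using a by simp
  then have n1: "n1 = 0" using nn by simp
  then have f: "f = 0" using q by simp
  have "g^2 = b^2" using q f by simp
  then have gb: "g = b \<or> g = - b" by (simp add: power2_eq_iff)
  have lin: "1 = 2 * a * (g - n2 * b)" using q n1 by (simp add: algebra_simps)
  have s: "n2 = 1 \<or> n2 = - 1" using n2 by (simp add: power2_eq_1_iff)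
  \<comment> \<open>The choice \<open>g = n2 * b\<close> would put the focus on the directrix; \<open>lin\<close> excludes it.\<close>
  have g: "g = - n2 * b" using gb s lin by auto
  have nb: "n2 * b = - g" using g by simp
  then have "1 = 4 * a * g" using lin by simp
  then have ga: "g = 1 / (4 * a)" using a by (simp add: field_simps)
  show "F = h *\<^sub>R u + (1 / (4 * a)) *\<^sub>R perp u"
    using frame_expansion[OF u, of F] f ga by (simp add: defs)
  have "n = n2 *\<^sub>R perp u" using frame_expansion[OF u, of n] n1 by (simp add: defs)
  moreover have "c = b" using n1 by (simp add: defs)
  ultimately have "D = {x. n2 * (x \<bullet> perp u) = b}" by (simp add: D)
  also have "\<dots> = {x. x \<bullet> perp u = n2 * b}" using s by auto
  finally show "D = {x. x \<bullet> perp u = - 1 / (4 * a)}" using nb ga by simp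
qed

lemma parabola_focus_frame_parabola:
  assumes "norm u = 1" "a \<noteq> 0"
  shows "parabola_focus (frame_parabola u h a) = h *\<^sub>R u + (1 / (4 * a)) *\<^sub>R perp u"
  unfolding parabola_focus_def
  using focus_directrix_frame_parabola[OF assms] focus_directrix_unique_frame_parabola(1)[OF assms]
  by blast

text \<open>Focus and directrix being unique, orthogonality to the directrix just says that the point lies on
  the axis, and the axis meets the parabola once.\<close>

lemma parabola_vertex_frame_parabola:
  assumes u: "norm u = 1" and a: "a \<noteq> 0"
  shows "parabola_vertex (frame_parabola u h a) = h *\<^sub>R u"
proof -
  define F where "F = h *\<^sub>R u + (1 / (4 * a)) *\<^sub>R perp u"
  define D where "D = {x. x \<bullet> perp u = - 1 / (4 * a)}"
  have uu: "u \<bullet> u = 1" using u by (simp add: dot_square_norm)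
  have fd: "focus_directrix_conic (frame_parabola u h a) F' D' 1 \<longleftrightarrow> F' = F \<and> D' = D" for F' D'
    using focus_directrix_frame_parabola[OF u a] focus_directrix_unique_frame_parabola[OF u a]
    unfolding F_def D_def by blast
  have axis: "(\<forall>x\<in>D. \<forall>y\<in>D. (p - F) \<bullet> (x - y) = 0) \<longleftrightarrow> p \<bullet> u = h" for p
  proof
    assume orth: "\<forall>x\<in>D. \<forall>y\<in>D. (p - F) \<bullet> (x - y) = 0"
    define y where "y = (- 1 / (4 * a)) *\<^sub>R perp u"
    have "y \<in> D" "u + y \<in> D" by (simp_all add: D_def y_def inner_add_left inner_diff_left uu)
    then have "(p - F) \<bullet> (u + y - y) = 0" using orth by blast
    then show "p \<bullet> u = h" by (simp add: F_def inner_diff_left inner_add_left uu)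
  next
    assume p: "p \<bullet> u = h"
    show "\<forall>x\<in>D. \<forall>y\<in>D. (p - F) \<bullet> (x - y) = 0"
    proof (intro ballI)
      fix x y assume "x \<in> D" "y \<in> D"
      then have "(x - y) \<bullet> perp u = 0" by (simp add: D_def inner_diff_left)
      moreover have "(p - F) \<bullet> u = 0" using p by (simp add: F_def inner_diff_left inner_add_left uu)
      then have "p - F = ((p - F) \<bullet> perp u) *\<^sub>R perp u" using frame_expansion[OF u, of "p - F"] by simp
      then have "(p - F) \<bullet> (x - y) = ((p - F) \<bullet> perp u) * (perp u \<bullet> (x - y))"
        by (metis inner_scaleR_left)
      ultimately show "(p - F) \<bullet> (x - y) = 0" by (simp add: inner_commute)
    qed
  qed
  have "p = h *\<^sub>R u" if "p \<in> frame_parabola u h a" "p \<bullet> u = h" for p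
  proof -
    have "p \<bullet> perp u = 0" using that by (simp add: frame_parabola_def)
    then show ?thesis using frame_expansion[OF u, of p] unfolding that(2) by simp
  qed
  moreover have "h *\<^sub>R u \<in> frame_parabola u h a" "(h *\<^sub>R u) \<bullet> u = h"
    by (simp_all add: frame_parabola_def uu)
  moreover have "parabola_vertex (frame_parabola u h a) =
      (THE p. p \<in> frame_parabola u h a \<and> p \<bullet> u = h)"
    unfolding parabola_vertex_def fd using axis by simp
  ultimately show ?thesis by (metis (mono_tags, lifting) the_equality)
qed

section \<open>Normals of the carrier conics\<close>

lemma norm_direction: "norm (vector [cos \<phi>, sin \<phi>] :: real^2) = 1"
  by (simp add: norm_vec_def L2_set_def sum_2)

text \<open>On the focus side of the directrix the absolute value in \<open>norm p = (R / d) * \<bar>p$1 - d\<bar>\<close> resolves,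
  leaving a linear equation for the distance \<open>r\<close> along the ray.\<close>

lemma P_point_eq:
  assumes R: "R > 0" and d: "d > 0" and c: "cos \<phi> > 0"
  shows "P_point R (vector [cos \<phi>, sin \<phi>]) d =
    (R / (1 + R / d * cos \<phi>)) *\<^sub>R vector [cos \<phi>, sin \<phi>]" (is "P_point R ?u d = ?r *\<^sub>R ?u")
  unfolding P_point_def
proof (rule the_equality)
  have pos: "1 + R / d * cos \<phi> > 0" using R d c by (simp add: add_pos_pos)
  then show "?r *\<^sub>R ?u \<in> open_ray ?u \<inter> focus_branch R d"
    unfolding focus_branch_polar[OF R d] open_ray_def using R by force
  fix p assume p: "p \<in> open_ray ?u \<inter> focus_branch R d"
  then obtain r where r: "r > 0" "p = r *\<^sub>R ?u" by (auto simp: open_ray_def)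
  have "norm p = R / d * (d - p$1)" using p by (auto simp: focus_branch_def self_directrix[OF R d])
  then have "r = R / d * (d - r * cos \<phi>)" using r by (simp add: norm_direction)
  then have "r * (1 + R / d * cos \<phi>) = R" using d by (simp add: field_simps)
  then show "p = ?r *\<^sub>R ?u" using pos r by (simp add: nonzero_eq_divide_eq)
qed

text \<open>The curve is the polar parametrization, centred at \<open>\<phi>\<close> so that its position and velocity at time 0
  are expressed in the frame \<open>u\<close>, \<open>perp u\<close>. The equation is the squared focus-directrix relation,
  which unlike the norm is a polynomial.\<close>

lemma tangent_line_Gamma_conic:
  fixes \<phi> R d :: real
  assumes R: "R > 0" and d: "d > 0" and c: "cos \<phi> > 0"
  defines "u \<equiv> vector [cos \<phi>, sin \<phi>] :: real^2" and "r \<equiv> R / (1 + R / d * cos \<phi>)"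
  shows "tangent_line (Gamma_conic R d) (r *\<^sub>R u) =
    line (r *\<^sub>R u) ((r * (R / d * sin \<phi>) / R) *\<^sub>R u + perp u)"
proof -
  define e where "e = R / d"
  define k where "k = r * (e * sin \<phi>) / R"
  define w where "w = k *\<^sub>R u + perp u"
  define \<rho> where "\<rho> t = R / (1 + e * cos (\<phi> + t))" for t
  define \<gamma> where "\<gamma> t = \<rho> t *\<^sub>R (cos t *\<^sub>R u + sin t *\<^sub>R perp u)" for t
  have e: "e > 0" using R d by (simp add: e_def)
  have pos: "1 + e * cos \<phi> > 0" using e c by (simp add: add_pos_pos)
  have re: "r = R / (1 + e * cos \<phi>)" by (simp add: r_def e_def)
  have r: "r > 0" using pos R by (simp add: re)
  have u: "norm u = 1" by (simp add: u_def norm_direction)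
  have uu: "u \<bullet> u = 1" using u by (simp add: dot_square_norm)
  \<comment> \<open>The derivative of the polar radius is \<open>r\<^sup>2 e sin \<phi> / R\<close>, that is \<open>r k\<close>.\<close>
  have \<rho>': "(\<rho> has_real_derivative r * k) (at 0)"
    unfolding \<rho>_def using pos R
    by (auto intro!: derivative_eq_intros simp: k_def re power2_eq_square)
  have \<rho>0: "\<rho> 0 = r" by (simp add: \<rho>_def re)
  have "(\<gamma> has_vector_derivative r *\<^sub>R w) (at 0)"
    unfolding \<gamma>_def w_def
    by (auto intro!: derivative_eq_intros \<rho>' simp: \<rho>0 scaleR_add_right
        has_real_derivative_iff_has_vector_derivative[symmetric])
  moreover have "\<gamma> 0 = r *\<^sub>R u" by (simp add: \<gamma>_def \<rho>_def re)
  moreover have "\<forall>\<^sub>F t in nhds 0. \<gamma> t \<in> Gamma_conic R d"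
  proof -
    have "((\<lambda>t. 1 + e * cos (\<phi> + t)) \<longlongrightarrow> 1 + e * cos (\<phi> + 0)) (nhds 0)"
      by (intro tendsto_intros filterlim_ident)
    then have "\<forall>\<^sub>F t in nhds 0. 1 + e * cos (\<phi> + t) > 0"
      using pos by (intro order_tendstoD(1)) auto
    then show ?thesis
    proof eventually_elim
      case (elim t)
      have "cos t *\<^sub>R u + sin t *\<^sub>R perp u = vector [cos (\<phi> + t), sin (\<phi> + t)]"
        by (simp add: u_def perp_def vec_eq_iff forall_2 cos_add sin_add algebra_simps)
      then have "\<gamma> t \<in> focus_branch R d"
        unfolding focus_branch_polar[OF R d] \<gamma>_def \<rho>_def using elim e_def by auto
      then show ?case by (simp add: focus_branch_def)
    qed
  qed
  moreover have "w \<bullet> perp u = 1" by (simp add: w_def inner_add_left uu)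
  then have w: "w \<noteq> 0" by auto
  moreover have "((\<lambda>x. x \<bullet> x - e^2 * (x$1 - d)^2) has_derivative
      (\<lambda>h. 2 * r * (h \<bullet> u + e * h$1))) (at (r *\<^sub>R u))"
  proof -
    have "r * (1 + e * cos \<phi>) = R" using pos by (simp add: re)
    then have "e * (r * cos \<phi> - d) = - r" using d by (simp add: e_def field_simps)
    then have "e^2 * (r * cos \<phi> - d) = - (e * r)"
      by (simp add: power2_eq_square mult.assoc)
    then have "2 * r * (h \<bullet> u + e * h$1) = 2 * r * (h \<bullet> u) - 2 * (e^2 * (r * cos \<phi> - d)) * h$1" for h
      by (simp only:) (simp add: algebra_simps)
    then show ?thesis
      by (auto intro!: derivative_eq_intros bounded_linear_imp_has_derivative[OF bounded_linear_vec_nth]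
          simp: fun_eq_iff u_def inner_commute algebra_simps)
  qed
  moreover have "x \<bullet> x - e^2 * (x$1 - d)^2 = 0" if "x \<in> Gamma_conic R d" for x
  proof -
    have "norm x = e * \<bar>x$1 - d\<bar>" using that by (simp add: self_directrix[OF R d] e_def)
    then have "(norm x)^2 = e^2 * (x$1 - d)^2" by (simp add: power_mult_distrib)
    then show ?thesis by (simp add: dot_square_norm)
  qed
  \<comment> \<open>Up to a nonzero factor the derivative at \<open>perp w\<close> is \<open>1 + e cos \<phi>\<close> plus a nonnegative term.\<close>
  moreover have "2 * r * (perp (r *\<^sub>R w) \<bullet> u + e * perp (r *\<^sub>R w) $ 1) \<noteq> 0"
  proof -
    have "perp w \<bullet> u + e * perp w $ 1 = - (1 + e * cos \<phi> + e * k * sin \<phi>)"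
      by (simp add: w_def perp_add perp_scaleR inner_diff_left uu)
        (simp add: u_def perp_def algebra_simps)
    moreover have "e * k * sin \<phi> \<ge> 0"
    proof -
      have "e * k * sin \<phi> = e * e * (r / R) * (sin \<phi> * sin \<phi>)" by (simp add: k_def)
      then show ?thesis using e r R by simp
    qed
    ultimately have "perp w \<bullet> u + e * perp w $ 1 \<noteq> 0" using pos by linarith
    moreover have "perp (r *\<^sub>R w) \<bullet> u + e * perp (r *\<^sub>R w) $ 1 = r * (perp w \<bullet> u + e * perp w $ 1)"
      by (simp add: perp_scaleR algebra_simps)
    ultimately show ?thesis using r by simp
  qed
  ultimately have "tangent_line (Gamma_conic R d) (r *\<^sub>R u) = line (r *\<^sub>R u) (r *\<^sub>R w)"
    using r
    by (intro tangent_line_eqI[where \<gamma> = \<gamma> and F = "\<lambda>x. x \<bullet> x - e^2 * (x$1 - d)^2"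
          and F' = "\<lambda>h. 2 * r * (h \<bullet> u + e * h$1)"]) simp_all
  then show ?thesis using w r by (simp add: line_scaleR w_def k_def e_def)
qed

text \<open>The polar equation eliminates the eccentricity, \<open>(R / d) r cos \<phi> = R - r\<close>, so the normals form a
  one-parameter family in \<open>r\<close> alone.\<close>

lemma N_line_eq:
  fixes \<phi> R d :: real
  assumes R: "R > 0" and d: "d > 0" and c: "cos \<phi> > 0"
  defines "u \<equiv> vector [cos \<phi>, sin \<phi>] :: real^2" and "r \<equiv> R / (1 + R / d * cos \<phi>)"
  shows "N_line R u d =
    {x. x \<bullet> perp u = tan \<phi> / R * (r - R) * (x \<bullet> u) + tan \<phi> / R * (R - r) * r}"
proof -
  have uu: "u \<bullet> u = 1" by (simp add: u_def dot_square_norm norm_direction)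
  have pos: "1 + R / d * cos \<phi> > 0" using R d c by (simp add: add_pos_pos)
  define k where "k = r * (R / d * sin \<phi>) / R"
  have "r * (1 + R / d * cos \<phi>) = R" using pos by (simp add: r_def)
  then have "r * (R / d * cos \<phi>) = R - r" by (simp add: algebra_simps)
  moreover have "k = tan \<phi> / R * (r * (R / d * cos \<phi>))" using c by (simp add: k_def tan_def)
  ultimately have k: "k = tan \<phi> / R * (R - r)" by simp
  have "N_line R u d = {x. (x - r *\<^sub>R u) \<bullet> (k *\<^sub>R u + perp u) = 0}"
    using normal_line_eq[OF tangent_line_Gamma_conic[OF R d c]] P_point_eq[OF R d c]
    by (simp add: N_line_def u_def r_def k_def)
  also have "\<dots> = {x. x \<bullet> perp u = - k * (x \<bullet> u) + k * r}"
    by (auto simp: inner_diff_left inner_add_right uu algebra_simps)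
  also have "- k = tan \<phi> / R * (r - R)" unfolding k by (simp only: minus_mult_right minus_diff_eq)
  finally show ?thesis by (simp add: k)
qed

text \<open>Slopes already force the abscissa of contact; for that abscissa the intercepts agree because
  \<open>R\<^sup>2 - s\<^sup>2 = (R - s) (R + s) = 4 r (R - r)\<close>.\<close>

lemma N_line_eq_tangent_iff:
  fixes \<phi> R d :: real
  assumes R: "R > 0" and d: "d > 0" and c: "cos \<phi> > 0" and t: "tan \<phi> \<noteq> 0"
  defines "u \<equiv> vector [cos \<phi>, sin \<phi>] :: real^2"
  assumes q: "q \<in> frame_parabola u R (tan \<phi> / (4 * R))"
  shows "N_line R u d = tangent_line (frame_parabola u R (tan \<phi> / (4 * R))) q \<longleftrightarrow>
    q \<bullet> u = 2 * (R / (1 + R / d * cos \<phi>)) - R"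
proof -
  define r where "r = R / (1 + R / d * cos \<phi>)"
  define s where "s = q \<bullet> u"
  define T where "T = tan \<phi> / R"
  have T: "T \<noteq> 0" using t R by (simp add: T_def)
  have a: "tan \<phi> / (4 * R) = T / 4" by (simp add: T_def)
  have u: "norm u = 1" by (simp add: u_def norm_direction)
  have N: "N_line R u d = {x. x \<bullet> perp u = T * (r - R) * (x \<bullet> u) + T * (R - r) * r}"
    using N_line_eq[OF R d c] by (simp add: u_def r_def T_def)
  have tl: "tangent_line (frame_parabola u R (tan \<phi> / (4 * R))) q =
      {x. x \<bullet> perp u = T * ((s - R) / 2) * (x \<bullet> u) + T * ((R^2 - s^2) / 4)}"
    unfolding tangent_line_frame_parabola[OF u q] unfolding a
    by (rule Collect_cong) (simp add: s_def field_simps)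
  have "N_line R u d = tangent_line (frame_parabola u R (tan \<phi> / (4 * R))) q \<longleftrightarrow>
      T * (r - R) = T * ((s - R) / 2) \<and> T * (R - r) * r = T * ((R^2 - s^2) / 4)"
    unfolding N tl by (rule frame_line_eq_iff[OF u])
  also have "\<dots> \<longleftrightarrow> r - R = (s - R) / 2 \<and> T * ((R - r) * r) = T * ((R^2 - s^2) / 4)"
    using T by (simp only: mult.assoc mult_cancel_left simp_thms)
  also have "\<dots> \<longleftrightarrow> r - R = (s - R) / 2 \<and> (R - r) * r = (R^2 - s^2) / 4"
    using T by (simp only: mult_cancel_left simp_thms)
  also have "\<dots> \<longleftrightarrow> s = 2 * r - R"
  proof
    assume "s = 2 * r - R"
    then show "r - R = (s - R) / 2 \<and> (R - r) * r = (R^2 - s^2) / 4"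
      by (simp only:) (simp add: power2_eq_square algebra_simps)
  qed auto
  finally show ?thesis by (simp add: s_def r_def)
qed

lemma polar_radius_range:
  fixes R c :: real
  assumes R: "R > 0" and c: "c > 0"
  shows "(\<exists>d>0. r = R / (1 + R / d * c)) \<longleftrightarrow> 0 < r \<and> r < R"
proof
  assume "\<exists>d>0. r = R / (1 + R / d * c)"
  then obtain d where d: "d > 0" "r = R / (1 + R / d * c)" by blast
  have "R / d * c > 0" using R c d by simp
  then show "0 < r \<and> r < R" using R by (simp add: d(2) divide_less_eq add_pos_pos)
next
  assume r: "0 < r \<and> r < R"
  \<comment> \<open>Solving \<open>r (1 + (R / d) c) = R\<close> for \<open>d\<close>.\<close>
  define d where "d = r * c * R / (R - r)"
  have "d > 0" using r R c by (simp add: d_def)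
  moreover have "r = R / (1 + R / d * c)"
    using r R c by (simp add: d_def field_simps)
  ultimately show "\<exists>d>0. r = R / (1 + R / d * c)" by blast
qed

lemma latus_rectum_line_Gamma_conic:
  assumes R: "R > 0" and d: "d > 0"
  shows "is_latus_rectum_line (Gamma_conic R d) 0 (vertical_line 0)"
proof -
  have v: "vertical_line d = {x. x \<bullet> axis 1 1 = d}"
    by (simp add: vertical_line_def inner_axis)
  have "focus_directrix_conic (Gamma_conic R d) 0 (vertical_line d) (R / d)"
    unfolding focus_directrix_conic_def
  proof (intro conjI)
    show "is_line (vertical_line d)" unfolding v is_line_normal_form by (metis norm_axis_1)
    show "Gamma_conic R d = {p. dist p 0 = R / d * infdist p (vertical_line d)}"
      unfolding v self_directrix[OF R d] infdist_hyperplane[OF norm_axis_1]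
      by (simp add: inner_axis)
  qed (use R d in \<open>auto simp: vertical_line_def\<close>)
  moreover have "vertical_line 0 = {0 + (x - y) | x y. x \<in> vertical_line d \<and> y \<in> vertical_line d}"
  proof (intro set_eqI iffI)
    fix p assume "p \<in> vertical_line 0"
    then have "p = 0 + ((p + vector [d, 0]) - vector [d, 0])"
      "p + vector [d, 0] \<in> vertical_line d" "vector [d, 0] \<in> vertical_line d"
      by (simp_all add: vertical_line_def)
    then show "p \<in> {0 + (x - y) | x y. x \<in> vertical_line d \<and> y \<in> vertical_line d}" by blast
  qed (auto simp: vertical_line_def)
  ultimately show ?thesis unfolding is_latus_rectum_line_def by blast
qed

section \<open>The envelope\<close>

theorem theorem3p1:
  fixes R \<phi> :: real and u v :: "real^2" and L :: "(real^2) set" and Par :: "(real^2) set"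
  assumes R: "R > 0"
    and phi: "- pi / 2 < \<phi>" "\<phi> < pi / 2" "\<phi> \<noteq> 0"
    and u: "u = vector [cos \<phi>, sin \<phi>]"
    and v: "v = vector [- sin \<phi>, cos \<phi>]"
    and L: "L = {t *\<^sub>R u | t. True}"
    and Par: "Par = {\<xi> *\<^sub>R u + \<eta> *\<^sub>R v | \<xi> \<eta>. \<eta> = tan \<phi> / (4 * R) * (R - \<xi>)^2}"
  shows
    "(is_parabola Par \<and>
      (\<forall>d>0. \<exists>q\<in>Par. N_line R u d = tangent_line Par q)) \<and>
     ({q \<in> Par. \<exists>d>0. N_line R u d = tangent_line Par q} =
        {\<xi> *\<^sub>R u + \<eta> *\<^sub>R v | \<xi> \<eta>. \<eta> = tan \<phi> / (4 * R) * (R - \<xi>)^2 \<and> - R < \<xi> \<and> \<xi> < R}) \<and>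
     (parabola_vertex Par = R *\<^sub>R u \<and>
      R *\<^sub>R u \<in> frontier (ball 0 R) \<and>
      tangent_line Par (R *\<^sub>R u) = L) \<and>
     (parabola_focus Par = R *\<^sub>R u + (R * cot \<phi>) *\<^sub>R v \<and>
      R *\<^sub>R u + (R * cot \<phi>) *\<^sub>R v = vector [0, R / sin \<phi>] \<and>
      parabola_focus Par \<in> vertical_line 0 \<and>
      (\<forall>d>0. is_latus_rectum_line (Gamma_conic R d) 0 (vertical_line 0)))"
proof -
  define a where "a = tan \<phi> / (4 * R)"
  have c: "cos \<phi> > 0" using phi by (intro cos_gt_zero_pi) auto
  have s: "sin \<phi> \<noteq> 0"
    using phi sin_gt_zero[of \<phi>] sin_gt_zero[of "- \<phi>"] pi_gt_zero
    by (cases "\<phi> > 0") (auto simp del: pi_gt_zero)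
  have t: "tan \<phi> \<noteq> 0" using c s by (simp add: tan_def)
  have a: "a \<noteq> 0" using t R by (simp add: a_def)
  have vp: "v = perp u" by (simp add: u v perp_def)
  have nu: "norm u = 1" by (simp add: u norm_direction)
  have uu: "u \<bullet> u = 1" using nu by (simp add: dot_square_norm)
  have mem: "(\<exists>\<xi> \<eta>. x = \<xi> *\<^sub>R u + \<eta> *\<^sub>R v \<and> \<eta> = a * (R - \<xi>)^2 \<and> Q \<xi>) \<longleftrightarrow>
      x \<in> frame_parabola u R a \<and> Q (x \<bullet> u)" for x Q
  proof
    assume x: "x \<in> frame_parabola u R a \<and> Q (x \<bullet> u)"
    then have "x \<bullet> v = a * (R - x \<bullet> u)^2"
      by (simp add: vp frame_parabola_def power2_commute)
    moreover have "x = (x \<bullet> u) *\<^sub>R u + (x \<bullet> v) *\<^sub>R v"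
      unfolding vp by (rule frame_expansion[OF nu])
    ultimately show "\<exists>\<xi> \<eta>. x = \<xi> *\<^sub>R u + \<eta> *\<^sub>R v \<and> \<eta> = a * (R - \<xi>)^2 \<and> Q \<xi>"
      using x by blast
  qed (auto simp: vp frame_parabola_def inner_add_left uu power2_commute)
  have P: "Par = frame_parabola u R a"
    using mem[where Q = "\<lambda>_. True"] unfolding Par a_def by auto
  have arc: "{\<xi> *\<^sub>R u + \<eta> *\<^sub>R v | \<xi> \<eta>. \<eta> = tan \<phi> / (4 * R) * (R - \<xi>)^2 \<and> - R < \<xi> \<and> \<xi> < R}
      = {q \<in> Par. - R < q \<bullet> u \<and> q \<bullet> u < R}"
    using mem[where Q = "\<lambda>\<xi>. - R < \<xi> \<and> \<xi> < R"] unfolding P a_def by auto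
  have touch: "N_line R u d = tangent_line Par q \<longleftrightarrow>
      q \<bullet> u = 2 * (R / (1 + R / d * cos \<phi>)) - R" if "d > 0" "q \<in> Par" for d q
    using N_line_eq_tangent_iff[OF R that(1) c t, of q] that(2) by (simp add: P u a_def)
  have 1: "\<exists>q\<in>Par. N_line R u d = tangent_line Par q" if d: "d > 0" for d
  proof -
    define \<xi> where "\<xi> = 2 * (R / (1 + R / d * cos \<phi>)) - R"
    define q where "q = \<xi> *\<^sub>R u + (a * (\<xi> - R)^2) *\<^sub>R perp u"
    have "q \<bullet> u = \<xi>" by (simp add: q_def inner_add_left uu)
    moreover from this have "q \<in> Par" by (simp add: P frame_parabola_def) (simp add: q_def inner_add_left uu)
    ultimately show ?thesis using touch[OF d, of q] \<xi>_def by blast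
  qed
  have 2: "(\<exists>d>0. N_line R u d = tangent_line Par q) \<longleftrightarrow> - R < q \<bullet> u \<and> q \<bullet> u < R"
    if q: "q \<in> Par" for q
  proof -
    have "(\<exists>d>0. N_line R u d = tangent_line Par q) \<longleftrightarrow>
        (\<exists>d>0. (q \<bullet> u + R) / 2 = R / (1 + R / d * cos \<phi>))"
    proof -
      have "q \<bullet> u = 2 * x - R \<longleftrightarrow> (q \<bullet> u + R) / 2 = x" for x by auto
      then show ?thesis using touch[OF _ q] by metis
    qed
    also have "\<dots> \<longleftrightarrow> 0 < (q \<bullet> u + R) / 2 \<and> (q \<bullet> u + R) / 2 < R"
      by (rule polar_radius_range[OF R c])
    finally show ?thesis by auto
  qed
  have V: "R *\<^sub>R u \<in> frame_parabola u R a" by (simp add: frame_parabola_def uu)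
  have "L = line 0 u" by (simp add: L line_def)
  also have "\<dots> = {x. x \<bullet> perp u = 0}" using nu line_conv_perp[of u 0] by force
  finally have TL: "tangent_line Par (R *\<^sub>R u) = L"
    unfolding P tangent_line_frame_parabola[OF nu V] by (simp add: uu)
  have "1 / (4 * a) = R * cot \<phi>" using R t s c by (simp add: a_def tan_def cot_def)
  then have J: "parabola_focus Par = R *\<^sub>R u + (R * cot \<phi>) *\<^sub>R v"
    unfolding P vp parabola_focus_frame_parabola[OF nu a] by simp
  have "(R * sin \<phi> + R * cot \<phi> * cos \<phi>) * sin \<phi> = R * (cos \<phi> * (cot \<phi> * sin \<phi>) + sin \<phi> * sin \<phi>)"
    by (simp add: algebra_simps)
  also have "cot \<phi> * sin \<phi> = cos \<phi>" using s by (simp add: cot_def)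
  also have "R * (cos \<phi> * cos \<phi> + sin \<phi> * sin \<phi>) = R" by simp
  finally have "R * cos \<phi> - R * cot \<phi> * sin \<phi> = 0"
    "R * sin \<phi> + R * cot \<phi> * cos \<phi> = R / sin \<phi>"
    using s by (simp_all add: cot_def nonzero_eq_divide_eq)
  then have J': "R *\<^sub>R u + (R * cot \<phi>) *\<^sub>R v = vector [0, R / sin \<phi>]"
    by (simp add: u v vec_eq_iff forall_2)
  have "is_parabola Par"
    unfolding is_parabola_def P using focus_directrix_frame_parabola[OF nu a] by blast
  moreover have "{q \<in> Par. \<exists>d>0. N_line R u d = tangent_line Par q} =
      {\<xi> *\<^sub>R u + \<eta> *\<^sub>R v | \<xi> \<eta>. \<eta> = tan \<phi> / (4 * R) * (R - \<xi>)^2 \<and> - R < \<xi> \<and> \<xi> < R}"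
    unfolding arc using 2 by blast
  moreover have "R *\<^sub>R u \<in> frontier (ball 0 R)" using R nu by (simp add: frontier_ball)
  moreover have "parabola_focus Par \<in> vertical_line 0"
    unfolding J J' by (simp add: vertical_line_def)
  moreover have "parabola_vertex Par = R *\<^sub>R u"
    unfolding P by (rule parabola_vertex_frame_parabola[OF nu a])
  ultimately show ?thesis
    using 1 TL J J' latus_rectum_line_Gamma_conic[OF R] by (intro conjI allI impI) assumption+
qed

end
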